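(* Let $X$ be a Banach space over $\mathbb{C}$, $(\Omega,\Sigma)$ a measurable space, and $\mu=\{\mu_\Lambda \mid \Lambda\in X^*\}$ a vector projection family. If $f\in L^1(\mu)$, then the map $\int_\Omega f\,d\mu\colon X^*\to\mathbb{C}$, $\Lambda\mapsto\int_\Omega f\,d\mu_\Lambda$, is an element of the second dual $X^{**}$.
   Context: $X^*$ and $X^{**}$ are the (continuous) dual and second dual of $X$. $\mathcal{M}(\Omega)$ is the space of complex measures on $(\Omega,\Sigma)$. A net $(\mu_i)$ in $\mathcal{M}(\Omega)$ converges setwise to $\mu$ if $\mu_i(E)\to\mu(E)$ for every $E\in\Sigma$. A vector projection family is a collection $\{\mu_\Lambda \mid \Lambda\in X^*\}\subset\mathcal{M}(\Omega)$ such that (1) the map $X^*\to\mathcal{M}(\Omega)$, $\Lambda\mapsto\mu_\Lambda$, is linear; (2) if a net $(\Lambda_i)$ in $X^*$ converges in norm to $\Lambda$, then $\mu_{\Lambda_i}\to\mu_\Lambda$ setwise. A measurable function $f\colon\Omega\to\mathbb{C}$ is integrable, written $f\in L^1(\mu)$, if $f\in L^1(\mu_\Lambda)$ (that is, $\int|f|\,d|\mu_\Lambda|<\infty$) for each $\Lambda\in X^*$. *)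

theory Defs
  imports "HOL-Analysis.Analysis"
begin

section \<open>Complex Banach spaces and their duals\<close>

text \<open>The real scalar multiplication inherited from \<^class>\<open>real_normed_vector\<close> is required to be the
  restriction of the complex one, so the norm, the metric and the topology are the library's.\<close>

class complex_normed_vector = real_normed_vector +
  fixes scaleC :: "complex \<Rightarrow> 'a \<Rightarrow> 'a" (infixr "*\<^sub>C" 75)
  assumes scaleC_add_right: "a *\<^sub>C (x + y) = a *\<^sub>C x + a *\<^sub>C y"
    and scaleC_add_left: "(a + b) *\<^sub>C x = a *\<^sub>C x + b *\<^sub>C x"
    and scaleC_scaleC: "a *\<^sub>C b *\<^sub>C x = (a * b) *\<^sub>C x"
    and scaleC_complex_of_real: "complex_of_real r *\<^sub>C x = r *\<^sub>R x"
    and norm_scaleC: "norm (a *\<^sub>C x) = cmod a * norm x"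

class complex_banach = complex_normed_vector + banach

definition bounded_clinear :: "('a::complex_normed_vector \<Rightarrow> complex) \<Rightarrow> bool" where
  "bounded_clinear f \<longleftrightarrow> bounded_linear f \<and> (\<forall>c x. f (c *\<^sub>C x) = c * f x)"

typedef (overloaded) 'a cdual = "{f :: 'a::complex_normed_vector \<Rightarrow> complex. bounded_clinear f}"
  morphisms cdual_apply CDual
  by (rule exI[of _ "\<lambda>x. 0"]) (simp add: bounded_clinear_def)

setup_lifting type_definition_cdual

instantiation cdual :: (complex_normed_vector) complex_normed_vector
begin

lift_definition norm_cdual :: "'a cdual \<Rightarrow> real" is onorm .

lift_definition minus_cdual :: "'a cdual \<Rightarrow> 'a cdual \<Rightarrow> 'a cdual" is "\<lambda>f g x. f x - g x"
  by (auto simp: bounded_clinear_def bounded_linear_sub algebra_simps)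

lift_definition uminus_cdual :: "'a cdual \<Rightarrow> 'a cdual" is "\<lambda>f x. - f x"
  by (auto simp: bounded_clinear_def bounded_linear_minus)

lift_definition zero_cdual :: "'a cdual" is "\<lambda>x. 0"
  by (simp add: bounded_clinear_def)

lift_definition plus_cdual :: "'a cdual \<Rightarrow> 'a cdual \<Rightarrow> 'a cdual" is "\<lambda>f g x. f x + g x"
  by (auto simp: bounded_clinear_def bounded_linear_add algebra_simps)

lift_definition scaleR_cdual :: "real \<Rightarrow> 'a cdual \<Rightarrow> 'a cdual" is "\<lambda>r f x. r *\<^sub>R f x"
  by (auto simp: bounded_clinear_def bounded_linear_const_scaleR)

lift_definition scaleC_cdual :: "complex \<Rightarrow> 'a cdual \<Rightarrow> 'a cdual" is "\<lambda>c f x. c * f x"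
  by (auto simp: bounded_clinear_def bounded_linear_const_mult)

definition dist_cdual :: "'a cdual \<Rightarrow> 'a cdual \<Rightarrow> real"
  where "dist_cdual a b = norm (a - b)"

definition uniformity_cdual :: "('a cdual \<times> 'a cdual) filter"
  where "uniformity_cdual = (INF e\<in>{0 <..}. principal {(x, y). dist x y < e})"

definition open_cdual :: "'a cdual set \<Rightarrow> bool"
  where "open_cdual S = (\<forall>x\<in>S. \<forall>\<^sub>F (x', y) in uniformity. x' = x \<longrightarrow> y \<in> S)"

definition sgn_cdual :: "'a cdual \<Rightarrow> 'a cdual"
  where "sgn_cdual x = scaleR (inverse (norm x)) x"

lemma onorm_const_mult_complex:
  fixes f :: "'b::real_normed_vector \<Rightarrow> complex"
  assumes "bounded_linear f"
  shows "onorm (\<lambda>x. c * f x) = cmod c * onorm f"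
proof -
  have "onorm (\<lambda>x. c * f x) = onorm (\<lambda>x. cmod c *\<^sub>R f x)"
    by (simp add: onorm_def norm_mult)
  with onorm_scaleR[OF assms, of "cmod c"] show ?thesis by simp
qed

instance
proof
  fix a b :: "'a cdual" and r :: real and c :: complex
  show "norm (a + b) \<le> norm a + norm b"
    by transfer (simp add: bounded_clinear_def onorm_triangle)
  show "norm (r *\<^sub>R a) = \<bar>r\<bar> * norm a"
    by transfer (simp add: bounded_clinear_def onorm_scaleR[simplified])
  show "norm (c *\<^sub>C a) = cmod c * norm a"
    by transfer (simp add: bounded_clinear_def onorm_const_mult_complex)
  show "norm a = 0 \<longleftrightarrow> a = 0"
    by transfer (auto simp: bounded_clinear_def onorm_eq_0)
  show "complex_of_real r *\<^sub>C a = r *\<^sub>R a"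
    by transfer (simp add: scaleR_conv_of_real)
  show "sgn a = inverse (norm a) *\<^sub>R a"
    by (rule sgn_cdual_def)
  show "dist a b = norm (a - b)"
    by (rule dist_cdual_def)
  show "(uniformity :: ('a cdual \<times> 'a cdual) filter) =
      (INF e\<in>{0 <..}. principal {(x, y). dist x y < e})"
    by (rule uniformity_cdual_def)
  show "open U = (\<forall>x\<in>U. \<forall>\<^sub>F (x', y) in uniformity. x' = x \<longrightarrow> y \<in> U)" for U :: "'a cdual set"
    by (rule open_cdual_def)
qed (transfer; simp add: fun_eq_iff algebra_simps)+

end

section \<open>Complex measures\<close>

text \<open>The measurable space is the carrier and the sigma-algebra of a value \<^term>\<open>M :: 'w measure\<close>; the
  measure that \<^term>\<open>M\<close> carries is never used. Only the values of a set function on \<^term>\<open>sets M\<close>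
  matter.\<close>

definition complex_measures :: "'w measure \<Rightarrow> ('w set \<Rightarrow> complex) set" where
  "complex_measures M = {\<nu>. \<forall>A :: nat \<Rightarrow> 'w set. range A \<subseteq> sets M \<longrightarrow> disjoint_family A \<longrightarrow>
     (\<lambda>n. \<nu> (A n)) sums \<nu> (\<Union>n. A n)}"

definition setwise_tendsto ::
    "'w measure \<Rightarrow> ('i \<Rightarrow> 'w set \<Rightarrow> complex) \<Rightarrow> ('w set \<Rightarrow> complex) \<Rightarrow> 'i filter \<Rightarrow> bool" where
  "setwise_tendsto M \<nu> \<nu>' F \<longleftrightarrow> (\<forall>E\<in>sets M. ((\<lambda>i. \<nu> i E) \<longlongrightarrow> \<nu>' E) F)"

definition measurable_partitions :: "'w measure \<Rightarrow> 'w set \<Rightarrow> (nat \<Rightarrow> 'w set) set" where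
  "measurable_partitions M E = {A. range A \<subseteq> sets M \<and> disjoint_family A \<and> (\<Union>n. A n) = E}"

definition total_variation :: "'w measure \<Rightarrow> ('w set \<Rightarrow> complex) \<Rightarrow> 'w measure" where
  "total_variation M \<nu> = measure_of (space M) (sets M)
     (\<lambda>E. SUP A\<in>measurable_partitions M E. \<Sum>n. ennreal (cmod (\<nu> (A n))))"

text \<open>The positive part of the Jordan decomposition of a finite signed measure \<^term>\<open>r\<close>; the negative
  part is the positive part of \<^term>\<open>\<lambda>E. - r E\<close>. Negative values of \<^term>\<open>r\<close> are sent to 0 by
  \<^term>\<open>ennreal\<close>, which does not affect the supremum because \<^term>\<open>{}\<close> contributes 0.\<close>

definition positive_variation :: "'w measure \<Rightarrow> ('w set \<Rightarrow> real) \<Rightarrow> 'w measure" where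
  "positive_variation M r = measure_of (space M) (sets M)
     (\<lambda>E. SUP F\<in>{F \<in> sets M. F \<subseteq> E}. ennreal (r F))"

definition signed_integral :: "'w measure \<Rightarrow> ('w set \<Rightarrow> real) \<Rightarrow> ('w \<Rightarrow> complex) \<Rightarrow> complex" where
  "signed_integral M r f =
     (LINT x|positive_variation M r. f x) - (LINT x|positive_variation M (\<lambda>E. - r E). f x)"

definition complex_integral ::
    "'w measure \<Rightarrow> ('w set \<Rightarrow> complex) \<Rightarrow> ('w \<Rightarrow> complex) \<Rightarrow> complex" where
  "complex_integral M \<nu> f =
     signed_integral M (\<lambda>E. Re (\<nu> E)) f + \<i> * signed_integral M (\<lambda>E. Im (\<nu> E)) f"

text \<open>Both variations are genuine measures, so that \<^const>\<open>measure_of\<close> does not fall back to the zero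
  measure.\<close>

lemma measure_space_of_superadditive:
  fixes m :: "'w set \<Rightarrow> ennreal"
  assumes empty: "m {} = 0"
    and super: "\<And>A B. A \<in> sets M \<Longrightarrow> B \<in> sets M \<Longrightarrow> A \<inter> B = {} \<Longrightarrow> m A + m B \<le> m (A \<union> B)"
    and sub: "\<And>A :: nat \<Rightarrow> 'w set. range A \<subseteq> sets M \<Longrightarrow> disjoint_family A \<Longrightarrow>
      m (\<Union>n. A n) \<le> (\<Sum>n. m (A n))"
  shows "measure_space (space M) (sets M) m"
proof -
  have mono: "m A \<le> m B" if "A \<in> sets M" "B \<in> sets M" "A \<subseteq> B" for A B
  proof -
    have "m A + 0 \<le> m A + m (B - A)" by (rule add_left_mono) simp
    also have "\<dots> \<le> m (A \<union> (B - A))" using that by (intro super) auto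
    also have "A \<union> (B - A) = B" using that by auto
    finally show ?thesis by simp
  qed
  have "(\<Sum>n. m (A n)) = m (\<Union>n. A n)" if A: "range A \<subseteq> sets M" "disjoint_family A"
    for A :: "nat \<Rightarrow> 'w set"
  proof (rule antisym)
    have fin: "(\<Sum>n<N. m (A n)) \<le> m (\<Union>n<N. A n)" for N
    proof (induction N)
      case 0
      show ?case by (simp add: empty)
    next
      case (Suc N)
      have "A n \<inter> A N = {}" if "n < N" for n
        by (rule disjoint_family_onD[OF A(2)]) (use that in simp_all)
      then have disj: "(\<Union>n<N. A n) \<inter> A N = {}"
        by blast
      have meas: "A n \<in> sets M" for n
        using A(1) by blast
      have a: "(\<Sum>n<N. m (A n)) + m (A N) \<le> m (\<Union>n<N. A n) + m (A N)"
        by (rule add_right_mono) (rule Suc)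
      have b: "m (\<Union>n<N. A n) + m (A N) \<le> m ((\<Union>n<N. A n) \<union> A N)"
        by (rule super[OF _ meas disj]) (intro sets.finite_UN meas finite_lessThan)
      have c: "(\<Union>n<Suc N. A n) = (\<Union>n<N. A n) \<union> A N"
        by (simp add: lessThan_Suc Un_commute)
      show ?case
        unfolding sum.lessThan_Suc c by (rule order_trans[OF a b])
    qed
    have "(\<Sum>n<N. m (A n)) \<le> m (\<Union>n. A n)" for N
    proof -
      have "(\<Union>n<N. A n) \<in> sets M" "(\<Union>n. A n) \<in> sets M"
        using A(1) by (simp_all add: image_subset_iff sets.finite_UN sets.countable_UN)
      then have "m (\<Union>n<N. A n) \<le> m (\<Union>n. A n)"
        by (rule mono) blast
      with fin[of N] show ?thesis by (rule order_trans)
    qed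
    then show "(\<Sum>n. m (A n)) \<le> m (\<Union>n. A n)"
      unfolding suminf_eq_SUP by (rule SUP_least)
  qed (rule sub[OF A])
  then show ?thesis
    by (auto simp: measure_space_def positive_def countably_additive_def empty
        sets.sigma_algebra_axioms)
qed

lemma SUP_add_SUP_le:
  fixes f :: "'i \<Rightarrow> ennreal" and g :: "'j \<Rightarrow> ennreal"
  assumes "A \<noteq> {}" "B \<noteq> {}" and "\<And>a b. a \<in> A \<Longrightarrow> b \<in> B \<Longrightarrow> f a + g b \<le> c"
  shows "(SUP a\<in>A. f a) + (SUP b\<in>B. g b) \<le> c"
proof -
  have "f a + (SUP b\<in>B. g b) \<le> c" if "a \<in> A" for a
    unfolding ennreal_SUP_add_right[OF assms(2)]
    by (rule SUP_least) (rule assms(3)[OF that])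
  then show ?thesis
    unfolding ennreal_SUP_add_left[OF assms(1), symmetric] by (rule SUP_least)
qed

lemma complex_measure_empty:
  assumes "\<nu> \<in> complex_measures M"
  shows "\<nu> {} = 0"
proof -
  have "(\<lambda>n::nat. \<nu> {}) sums \<nu> {}"
    using assms unfolding complex_measures_def
    by (auto dest!: spec[of _ "\<lambda>n::nat. {}"] simp: disjoint_family_on_def)
  then have "(\<lambda>n::nat. \<nu> {}) \<longlonglongrightarrow> 0"
    by (rule summable_LIMSEQ_zero[OF sums_summable])
  then show ?thesis by (simp add: LIMSEQ_const_iff)
qed

lemma complex_measure_sums:
  assumes "\<nu> \<in> complex_measures M" "range A \<subseteq> sets M" "disjoint_family A"
  shows "(\<lambda>n. \<nu> (A n)) sums \<nu> (\<Union>n. A n)"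
  using assms by (auto simp: complex_measures_def)

lemma complex_measure_sums_Int:
  assumes "\<nu> \<in> complex_measures M" "range A \<subseteq> sets M" "disjoint_family A"
    and "F \<in> sets M" "F \<subseteq> (\<Union>n. A n)"
  shows "(\<lambda>n. \<nu> (F \<inter> A n)) sums \<nu> F"
proof -
  have "(\<lambda>n. \<nu> (F \<inter> A n)) sums \<nu> (\<Union>n. F \<inter> A n)"
    by (rule complex_measure_sums) (use assms in \<open>auto simp: disjoint_family_on_def\<close>)
  also have "(\<Union>n. F \<inter> A n) = F" using assms(5) by auto
  finally show ?thesis .
qed

lemma complex_measure_Un:
  assumes \<nu>: "\<nu> \<in> complex_measures M" and "A \<in> sets M" "B \<in> sets M" "A \<inter> B = {}"
  shows "\<nu> (A \<union> B) = \<nu> A + \<nu> B"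
proof -
  have "(\<lambda>n. \<nu> (binaryset A B n)) sums \<nu> (\<Union>n. binaryset A B n)"
    by (rule complex_measure_sums[OF \<nu>])
      (use assms in \<open>auto simp: binaryset_def disjoint_family_on_def\<close>)
  moreover have "(\<lambda>n. \<nu> (binaryset A B n)) sums (\<nu> A + \<nu> B)"
    by (rule binaryset_sums) (rule complex_measure_empty[OF \<nu>])
  ultimately show ?thesis
    by (metis UN_binaryset_eq sums_unique2)
qed

lemma ennreal_cmod_sums_le:
  assumes "f sums (s::complex)"
  shows "ennreal (cmod s) \<le> (\<Sum>n. ennreal (cmod (f n)))"
proof (cases "summable (\<lambda>n. cmod (f n))")
  case True
  have "cmod s \<le> (\<Sum>n. cmod (f n))"
    using summable_norm[OF True] sums_unique[OF assms] by simp
  then show ?thesis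
    using suminf_ennreal2[OF norm_ge_zero True] by (metis ennreal_leI)
next
  case False
  have "(\<Sum>n. ennreal (cmod (f n))) = top"
  proof (rule ccontr)
    assume "(\<Sum>n. ennreal (cmod (f n))) \<noteq> top"
    from summable_suminf_not_top[OF norm_ge_zero this] False show False by contradiction
  qed
  then show ?thesis by (metis top_greatest)
qed

lemma ennreal_real_sums_le:
  fixes f :: "nat \<Rightarrow> real"
  assumes "f sums s"
  shows "ennreal s \<le> (\<Sum>n. ennreal (f n))"
proof -
  have max_eq: "ennreal (max 0 x) = ennreal x" for x
    by (cases "x \<ge> 0") (simp_all add: ennreal_neg)
  have "ennreal s \<le> (\<Sum>n. ennreal (max 0 (f n)))"
  proof (cases "(\<Sum>n. ennreal (max 0 (f n))) = top")
    case True
    then show ?thesis by (metis top_greatest)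
  next
    case False
    have sm: "summable (\<lambda>n. max 0 (f n))"
      by (rule summable_suminf_not_top[OF _ False]) simp
    have "s \<le> (\<Sum>n. max 0 (f n))"
      by (rule sums_le[OF _ assms summable_sums[OF sm]]) simp
    moreover have "(\<Sum>n. ennreal (max 0 (f n))) = ennreal (\<Sum>n. max 0 (f n))"
      by (rule suminf_ennreal2[OF _ sm]) simp
    ultimately show ?thesis by (metis ennreal_leI)
  qed
  then show ?thesis by (simp only: max_eq)
qed

lemma measure_space_total_variation:
  assumes \<nu>: "\<nu> \<in> complex_measures M"
  shows "measure_space (space M) (sets M)
    (\<lambda>E. SUP A\<in>measurable_partitions M E. \<Sum>n. ennreal (cmod (\<nu> (A n))))"
    (is "measure_space _ _ ?m")
proof (rule measure_space_of_superadditive)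
  have "(\<Sum>n. ennreal (cmod (\<nu> (A n)))) \<le> 0" if "A \<in> measurable_partitions M {}"
    for A :: "nat \<Rightarrow> 'a set"
  proof -
    have "A n = {}" for n using that by (auto simp: measurable_partitions_def)
    then show ?thesis by (simp add: complex_measure_empty[OF \<nu>])
  qed
  then show "?m {} = 0"
    by (metis (no_types, lifting) SUP_least le_zero_eq)
next
  fix E F assume EF: "E \<in> sets M" "F \<in> sets M" "E \<inter> F = {}"
  have ne: "measurable_partitions M G \<noteq> {}" if "G \<in> sets M" for G
  proof -
    have "range (binaryset G {}) \<subseteq> sets M" "disjoint_family (binaryset G {})"
      using that by (auto simp: binaryset_def disjoint_family_on_def)
    moreover have "(\<Union>n. binaryset G {} n) = G" by (simp add: UN_binaryset_eq)
    ultimately have "binaryset G {} \<in> measurable_partitions M G"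
      unfolding measurable_partitions_def by blast
    then show ?thesis by blast
  qed
  have le: "(\<Sum>n. ennreal (cmod (\<nu> (A n)))) + (\<Sum>n. ennreal (cmod (\<nu> (B n)))) \<le> ?m (E \<union> F)"
    if A: "A \<in> measurable_partitions M E" and B: "B \<in> measurable_partitions M F" for A B
  proof -
    define C where "C n = (if even n then A (n div 2) else B (n div 2))" for n
    have disj: "C i \<inter> C j = {}" if "i \<noteq> j" for i j
    proof -
      have "A i \<inter> B j = {}" for i j
        using A B EF(3) by (auto simp: measurable_partitions_def)
      moreover have "A i \<inter> A j = {}" "B i \<inter> B j = {}" if "i \<noteq> j" for i j
        using A B that by (auto simp: measurable_partitions_def disjoint_family_on_def)
      moreover have "i div 2 \<noteq> j div 2" if "even i = even j"
        using that \<open>i \<noteq> j\<close> by presburger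
      ultimately show ?thesis
        unfolding C_def by (smt (verit) Int_commute)
    qed
    have un: "(\<Union>n. C n) = E \<union> F"
    proof -
      have "C (2 * n) = A n" "C (2 * n + 1) = B n" for n by (auto simp: C_def)
      then have "(\<Union>n. A n) \<union> (\<Union>n. B n) \<subseteq> (\<Union>n. C n)" by (metis UN_least UN_upper UNIV_I Un_least)
      moreover have "(\<Union>n. C n) \<subseteq> (\<Union>n. A n) \<union> (\<Union>n. B n)" by (auto simp: C_def split: if_splits)
      ultimately show ?thesis using A B by (auto simp: measurable_partitions_def)
    qed
    have C: "C \<in> measurable_partitions M (E \<union> F)"
      using disj un A B by (auto simp: measurable_partitions_def disjoint_family_on_def C_def)
    have "(\<Sum>n<N. ennreal (cmod (\<nu> (A n))) + ennreal (cmod (\<nu> (B n)))) =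
        (\<Sum>n<2 * N. ennreal (cmod (\<nu> (C n))))" for N
      by (induction N) (simp_all add: C_def add.assoc)
    moreover have "(\<Sum>n<2 * N. ennreal (cmod (\<nu> (C n)))) \<le> ?m (E \<union> F)" for N
      by (rule SUP_upper2[OF C]) (rule sum_le_suminf, auto)
    ultimately have "(\<Sum>n. ennreal (cmod (\<nu> (A n))) + ennreal (cmod (\<nu> (B n)))) \<le> ?m (E \<union> F)"
      unfolding suminf_eq_SUP by (intro SUP_least) simp
    then show ?thesis by (simp add: suminf_add)
  qed
  show "?m E + ?m F \<le> ?m (E \<union> F)"
  proof (rule SUP_add_SUP_le)
    show "measurable_partitions M E \<noteq> {}" "measurable_partitions M F \<noteq> {}"
      using ne EF by blast+
  qed (erule (1) le)
next
  fix E :: "nat \<Rightarrow> 'a set" assume E: "range E \<subseteq> sets M" "disjoint_family E"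
  show "?m (\<Union>k. E k) \<le> (\<Sum>k. ?m (E k))"
  proof (rule SUP_least)
    fix A assume A: "A \<in> measurable_partitions M (\<Union>k. E k)"
    have "(\<Sum>n. ennreal (cmod (\<nu> (A n)))) \<le> (\<Sum>n. \<Sum>k. ennreal (cmod (\<nu> (A n \<inter> E k))))"
    proof (rule suminf_le)
      fix n
      have "A n \<in> sets M" "A n \<subseteq> (\<Union>k. E k)"
        using A by (auto simp: measurable_partitions_def)
      then show "ennreal (cmod (\<nu> (A n))) \<le> (\<Sum>k. ennreal (cmod (\<nu> (A n \<inter> E k))))"
        by (intro ennreal_cmod_sums_le complex_measure_sums_Int[OF \<nu> E])
    qed auto
    also have "\<dots> = (\<integral>\<^sup>+n. (\<Sum>k. ennreal (cmod (\<nu> (A n \<inter> E k)))) \<partial>count_space UNIV)"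
      by (simp add: nn_integral_count_space_nat)
    also have "\<dots> = (\<Sum>k. \<integral>\<^sup>+n. ennreal (cmod (\<nu> (A n \<inter> E k))) \<partial>count_space UNIV)"
      by (rule nn_integral_suminf) simp
    also have "\<dots> = (\<Sum>k. \<Sum>n. ennreal (cmod (\<nu> (A n \<inter> E k))))"
      by (simp add: nn_integral_count_space_nat)
    also have "\<dots> \<le> (\<Sum>k. ?m (E k))"
    proof (rule suminf_le)
      fix k
      have "(\<lambda>n. A n \<inter> E k) \<in> measurable_partitions M (E k)"
        using A E by (auto simp: measurable_partitions_def disjoint_family_on_def) blast
      then show "(\<Sum>n. ennreal (cmod (\<nu> (A n \<inter> E k)))) \<le> ?m (E k)"
        by (rule SUP_upper2) simp
    qed auto
    finally show "(\<Sum>n. ennreal (cmod (\<nu> (A n)))) \<le> (\<Sum>k. ?m (E k))" .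
  qed
qed

lemma measure_space_positive_variation:
  assumes r: "(\<lambda>E. complex_of_real (r E)) \<in> complex_measures M"
  shows "measure_space (space M) (sets M) (\<lambda>E. SUP F\<in>{F \<in> sets M. F \<subseteq> E}. ennreal (r F))"
    (is "measure_space _ _ ?m")
proof (rule measure_space_of_superadditive)
  have r0: "r {} = 0" using complex_measure_empty[OF r] by simp
  have "{F \<in> sets M. F \<subseteq> {}} = {{}}" by auto
  then show "?m {} = 0" by (simp add: r0)
  fix E F assume EF: "E \<in> sets M" "F \<in> sets M" "E \<inter> F = {}"
  have le: "ennreal (r A) + ennreal (r B) \<le> ?m (E \<union> F)"
    if AB: "A \<in> sets M" "A \<subseteq> E" "B \<in> sets M" "B \<subseteq> F" for A B
  proof (cases "r A \<ge> 0 \<and> r B \<ge> 0")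
    case True
    have "complex_of_real (r (A \<union> B)) = complex_of_real (r A) + complex_of_real (r B)"
      by (rule complex_measure_Un[OF r]) (use AB EF in auto)
    then have "r (A \<union> B) = r A + r B" by (metis of_real_add of_real_eq_iff)
    then have "ennreal (r A) + ennreal (r B) = ennreal (r (A \<union> B))"
      using True by (simp add: ennreal_plus)
    also have "\<dots> \<le> ?m (E \<union> F)" by (rule SUP_upper) (use AB in auto)
    finally show ?thesis .
  next
    case False
    have "ennreal (r A) \<le> ?m (E \<union> F)" "ennreal (r B) \<le> ?m (E \<union> F)"
      by (rule SUP_upper; use AB in auto)+
    with False show ?thesis by (auto simp: ennreal_neg)
  qed
  show "?m E + ?m F \<le> ?m (E \<union> F)"
  proof (rule SUP_add_SUP_le)
    show "{A \<in> sets M. A \<subseteq> E} \<noteq> {}" "{A \<in> sets M. A \<subseteq> F} \<noteq> {}"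
      by auto
    fix A B assume "A \<in> {A \<in> sets M. A \<subseteq> E}" "B \<in> {A \<in> sets M. A \<subseteq> F}"
    then show "ennreal (r A) + ennreal (r B) \<le> ?m (E \<union> F)"
      by (intro le) blast+
  qed
next
  fix E :: "nat \<Rightarrow> 'a set" assume E: "range E \<subseteq> sets M" "disjoint_family E"
  show "?m (\<Union>k. E k) \<le> (\<Sum>k. ?m (E k))"
  proof (rule SUP_least)
    fix F assume F: "F \<in> {F \<in> sets M. F \<subseteq> (\<Union>k. E k)}"
    have "(\<lambda>k. complex_of_real (r (F \<inter> E k))) sums complex_of_real (r F)"
      using complex_measure_sums_Int[OF r E, of F] F by simp
    then have "(\<lambda>k. r (F \<inter> E k)) sums r F" by (simp only: sums_of_real_iff)
    then have "ennreal (r F) \<le> (\<Sum>k. ennreal (r (F \<inter> E k)))"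
      by (rule ennreal_real_sums_le)
    also have "\<dots> \<le> (\<Sum>k. ?m (E k))"
    proof (rule suminf_le)
      show "ennreal (r (F \<inter> E k)) \<le> ?m (E k)" for k
        by (rule SUP_upper) (use E F in auto)
    qed auto
    finally show "ennreal (r F) \<le> (\<Sum>k. ?m (E k))" .
  qed
qed

lemma emeasure_total_variation:
  assumes "\<nu> \<in> complex_measures M" "E \<in> sets M"
  shows "emeasure (total_variation M \<nu>) E =
    (SUP A\<in>measurable_partitions M E. \<Sum>n. ennreal (cmod (\<nu> (A n))))"
  using measure_space_total_variation[OF assms(1)] assms(2)
  unfolding total_variation_def measure_space_def by (intro emeasure_measure_of_sigma) blast+

lemma emeasure_positive_variation:
  assumes "(\<lambda>E. complex_of_real (r E)) \<in> complex_measures M" "E \<in> sets M"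
  shows "emeasure (positive_variation M r) E = (SUP F\<in>{F \<in> sets M. F \<subseteq> E}. ennreal (r F))"
  using measure_space_positive_variation[OF assms(1)] assms(2)
  unfolding positive_variation_def measure_space_def by (intro emeasure_measure_of_sigma) blast+

section \<open>Vector projection families\<close>

text \<open>A net in the dual enters only through its filter of tails, so nets converging in norm to
  \<^term>\<open>\<Lambda>\<close> are represented by the filters on the dual that converge to \<^term>\<open>\<Lambda>\<close>. The lemma
  below recovers the condition for families over an arbitrary index type.\<close>

definition vector_projection_family ::
    "'w measure \<Rightarrow> ('a::complex_banach cdual \<Rightarrow> 'w set \<Rightarrow> complex) \<Rightarrow> bool" where
  "vector_projection_family M \<mu> \<longleftrightarrow>
     (\<forall>\<Lambda>. \<mu> \<Lambda> \<in> complex_measures M) \<and>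
     (\<forall>\<Lambda> \<Gamma>. \<forall>E\<in>sets M. \<mu> (\<Lambda> + \<Gamma>) E = \<mu> \<Lambda> E + \<mu> \<Gamma> E) \<and>
     (\<forall>c \<Lambda>. \<forall>E\<in>sets M. \<mu> (c *\<^sub>C \<Lambda>) E = c * \<mu> \<Lambda> E) \<and>
     (\<forall>F \<Lambda>. ((\<lambda>\<Gamma>. \<Gamma>) \<longlongrightarrow> \<Lambda>) F \<longrightarrow> setwise_tendsto M \<mu> (\<mu> \<Lambda>) F)"

lemma vector_projection_family_net:
  assumes "vector_projection_family M \<mu>" and "(L \<longlongrightarrow> \<Lambda>) (F :: 'i filter)"
  shows "setwise_tendsto M (\<lambda>i. \<mu> (L i)) (\<mu> \<Lambda>) F"
proof -
  have "((\<lambda>\<Gamma>. \<Gamma>) \<longlongrightarrow> \<Lambda>) (filtermap L F)"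
    using assms(2) by (simp add: filterlim_def filtermap_filtermap)
  then have "setwise_tendsto M \<mu> (\<mu> \<Lambda>) (filtermap L F)"
    using assms(1) by (simp add: vector_projection_family_def)
  then show ?thesis
    by (simp add: setwise_tendsto_def filterlim_def filtermap_filtermap)
qed

definition vpf_integrable ::
    "'w measure \<Rightarrow> ('a::complex_banach cdual \<Rightarrow> 'w set \<Rightarrow> complex) \<Rightarrow> ('w \<Rightarrow> complex) \<Rightarrow> bool" where
  "vpf_integrable M \<mu> f \<longleftrightarrow>
     f \<in> borel_measurable M \<and>
     (\<forall>\<Lambda>. (\<integral>\<^sup>+x. ennreal (cmod (f x)) \<partial>total_variation M (\<mu> \<Lambda>)) < \<infinity>)"

end

theory Submission
  imports Defs
begin

text \<open>Approximate \<open>f\<close> by simple functions \<open>s\<^sub>n\<close> with \<open>\<bar>s\<^sub>n\<bar> \<le> 2\<bar>f\<bar>\<close>. Each functional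
  \<open>\<Lambda> \<mapsto> \<integral>s\<^sub>n d\<mu>\<^sub>\<Lambda>\<close> is a finite linear combination of the continuous linear functionals
  \<open>\<Lambda> \<mapsto> \<mu>\<^sub>\<Lambda>(E)\<close>, and by dominated convergence these functionals converge pointwise to
  \<open>\<Lambda> \<mapsto> \<integral>f d\<mu>\<^sub>\<Lambda>\<close>. The dual is complete, so a pointwise limit of continuous linear functionals
  on it is bounded by the Banach--Steinhaus theorem.\<close>

section \<open>Completeness of the dual and the Banach--Steinhaus theorem\<close>

lemma bounded_clinear_cdual_apply: "bounded_clinear (cdual_apply \<Lambda>)"
  using cdual_apply by blast

text \<open>Both sides are the operator norm of the same map, so Cauchy sequences and limits can be
  moved between \<open>cdual\<close> and the complete space of bounded real-linear maps.\<close>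

lemma norm_cdual_conv_blinfun:
  "norm (\<Lambda> - \<Gamma>) = norm (Blinfun (cdual_apply \<Lambda>) - Blinfun (cdual_apply \<Gamma>))"
proof -
  have bl: "bounded_linear (cdual_apply \<Lambda>)" for \<Lambda> :: "'a cdual"
    using bounded_clinear_cdual_apply[of \<Lambda>] by (simp add: bounded_clinear_def)
  have "norm (Blinfun (cdual_apply \<Lambda>) - Blinfun (cdual_apply \<Gamma>)) =
      onorm (\<lambda>x. cdual_apply \<Lambda> x - cdual_apply \<Gamma> x)"
    by (simp add: norm_blinfun.rep_eq minus_blinfun.rep_eq bounded_linear_Blinfun_apply[OF bl])
  then show ?thesis
    by (simp add: norm_cdual.rep_eq minus_cdual.rep_eq)
qed

text \<open>Banach--Steinhaus will be applied with the dual itself as domain, which calls for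
  completeness. The limit found among bounded real-linear maps is complex-linear because it is also
  a pointwise limit.\<close>

instance cdual :: (complex_normed_vector) banach
proof
  fix X :: "nat \<Rightarrow> 'a cdual" assume X: "Cauchy X"
  define Y where "Y n = Blinfun (cdual_apply (X n))" for n
  have Y_apply: "blinfun_apply (Y n) = cdual_apply (X n)" for n
    using bounded_clinear_cdual_apply[of "X n"]
    by (simp add: Y_def bounded_clinear_def bounded_linear_Blinfun_apply)
  have "Cauchy Y"
    using X unfolding Cauchy_def dist_norm Y_def norm_cdual_conv_blinfun .
  then obtain g where g: "Y \<longlonglongrightarrow> g"
    using Cauchy_convergent convergent_def by blast
  have lim: "(\<lambda>n. cdual_apply (X n) x) \<longlonglongrightarrow> blinfun_apply g x" for x
    using bounded_linear.tendsto[OF blinfun.bounded_linear_left g] by (simp add: Y_apply)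
  have "blinfun_apply g (c *\<^sub>C x) = c * blinfun_apply g x" for c x
  proof (rule LIMSEQ_unique[OF lim])
    have "cdual_apply (X n) (c *\<^sub>C x) = c * cdual_apply (X n) x" for n
      using bounded_clinear_cdual_apply[of "X n"] by (simp add: bounded_clinear_def)
    then show "(\<lambda>n. cdual_apply (X n) (c *\<^sub>C x)) \<longlonglongrightarrow> c * blinfun_apply g x"
      using tendsto_mult_left[OF lim] by simp
  qed
  then have "cdual_apply (CDual (blinfun_apply g)) = blinfun_apply g"
    by (intro CDual_inverse) (simp add: bounded_clinear_def blinfun.bounded_linear_right)
  then have "X \<longlonglongrightarrow> CDual (blinfun_apply g)"
    using g unfolding LIMSEQ_def dist_norm norm_cdual_conv_blinfun Y_def
    by (simp add: blinfun_apply_inverse)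
  then show "convergent X"
    by (rule convergentI)
qed

text \<open>Rescaling a nonzero vector to norm \<open>e\<close> yields the operator bound
  \<open>K / e\<close>.\<close>

lemma bounded_linear_if_bounded_on_cball:
  fixes S :: "'a::real_normed_vector \<Rightarrow> 'b::real_normed_vector"
  assumes S: "linear S" and e: "e > 0" and bound: "\<And>x. norm x \<le> e \<Longrightarrow> norm (S x) \<le> K"
  shows "bounded_linear S"
proof -
  have "norm (S x) \<le> norm x * (K / e)" for x
  proof (cases "x = 0")
    case True
    then show ?thesis using linear_0[OF S] by simp
  next
    case False
    have "norm (S ((e / norm x) *\<^sub>R x)) \<le> K"
      by (rule bound) (use False e in simp)
    then show ?thesis
      using False e by (simp add: linear_scale[OF S] field_simps)
  qed
  with S show ?thesis
    unfolding bounded_linear_def bounded_linear_axioms_def by blast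
qed

text \<open>Baire's theorem makes the \<open>T n\<close> uniformly bounded on some ball; this bound
  passes to \<open>S\<close>, and a linear map bounded on a ball is bounded.\<close>

lemma bounded_linear_pointwise_limit:
  fixes T :: "nat \<Rightarrow> 'a::banach \<Rightarrow> 'b::real_normed_vector"
  assumes T: "\<And>n. bounded_linear (T n)" and lim: "\<And>x. (\<lambda>n. T n x) \<longlonglongrightarrow> S x"
  shows "bounded_linear S"
proof -
  interpret T: bounded_linear "T n" for n by (rule T)
  have add: "S (x + y) = S x + S y" for x y
  proof (rule LIMSEQ_unique[OF lim])
    show "(\<lambda>n. T n (x + y)) \<longlonglongrightarrow> S x + S y"
      unfolding T.add by (intro tendsto_add lim)
  qed
  have scale: "S (r *\<^sub>R x) = r *\<^sub>R S x" for r x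
  proof (rule LIMSEQ_unique[OF lim])
    show "(\<lambda>n. T n (r *\<^sub>R x)) \<longlonglongrightarrow> r *\<^sub>R S x"
      unfolding T.scaleR by (intro tendsto_scaleR tendsto_const lim)
  qed
  have S: "linear S" by (rule linearI) (rule add scale)+
  \<comment> \<open>Convergent sequences are bounded, so these closed sets cover the space; they
    cannot all have empty interior.\<close>
  define A where "A k = {x. \<forall>n. norm (T n x) \<le> real k}" for k :: nat
  have closed: "closed (A k)" for k
    unfolding A_def
    by (intro closed_Collect_all closed_Collect_le continuous_intros T.continuous_on)
  have "\<exists>k. interior (A k) \<noteq> {}"
  proof (rule ccontr)
    assume empty: "\<not> (\<exists>k. interior (A k) \<noteq> {})"
    have "(euclidean :: 'a topology) interior_of (\<Union>(range A)) = {}"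
    proof (rule Baire_category_alt)
      show "closedin euclidean B \<and> euclidean interior_of B = {}" if "B \<in> range A" for B
        using that closed empty by auto
    qed (auto simp: completely_metrizable_space_euclidean)
    moreover have "x \<in> (\<Union>k. A k)" for x
    proof -
      have "Bseq (\<lambda>n. T n x)"
        using lim[of x] by (intro convergent_imp_Bseq convergentI)
      then obtain K where "\<And>n. norm (T n x) \<le> K"
        by (auto simp: Bseq_def)
      moreover obtain k :: nat where "K \<le> real k"
        using real_arch_simple by blast
      ultimately show ?thesis
        by (auto simp: A_def intro: order_trans)
    qed
    then have "(\<Union>k. A k) = UNIV"
      by blast
    ultimately show False
      by simp
  qed
  then obtain k a where "a \<in> interior (A k)"
    by blast
  then obtain e where e: "e > 0" "cball a e \<subseteq> A k"
    using mem_interior_cball by blast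
  have S_le: "norm (S x) \<le> real k" if "x \<in> A k" for x
    by (rule tendsto_upperbound[OF tendsto_norm[OF lim]]) (use that in \<open>auto simp: A_def\<close>)
  \<comment> \<open>The ball is centred at \<open>a\<close>, not at 0. Writing \<open>S y\<close> as
    a difference of two values on it moves the bound to 0 at the cost of a factor 2.\<close>
  have small: "norm (S y) \<le> 2 * real k" if "norm y \<le> e" for y
  proof -
    have "a + y \<in> A k" "a \<in> A k"
      using e that by (auto simp: dist_norm)
    then have "norm (S (a + y)) + norm (S a) \<le> real k + real k"
      by (intro add_mono S_le)
    moreover have "S y = S (a + y) - S a"
      by (simp add: add)
    ultimately show ?thesis
      using norm_triangle_ineq4[of "S (a + y)" "S a"] by simp
  qed
  show ?thesis
    by (rule bounded_linear_if_bounded_on_cball[OF S e(1)]) (rule small)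
qed

section \<open>Jordan decomposition of a complex measure\<close>

text \<open>If \<open>\<nu>\<close> were unbounded, repeatedly splitting a set on which it is unbounded would produce
  disjoint sets \<open>E\<^sub>n - E\<^sub>n\<^sub>+\<^sub>1\<close> of measure larger than 1 in modulus, and their series would
  diverge.\<close>

lemma complex_measure_bounded:
  assumes \<nu>: "\<nu> \<in> complex_measures M"
  shows "\<exists>K. \<forall>E\<in>sets M. cmod (\<nu> E) \<le> K"
proof (rule ccontr)
  assume unbounded: "\<not> ?thesis"
  define U where "U E \<longleftrightarrow> E \<in> sets M \<and> \<not> (\<exists>K. \<forall>F\<in>sets M. F \<subseteq> E \<longrightarrow> cmod (\<nu> F) \<le> K)" for E
  have step: "\<exists>B. U B \<and> B \<subseteq> E \<and> cmod (\<nu> (E - B)) > 1" if E: "U E" for E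
  proof -
    \<comment> \<open>This margin pushes both \<open>F\<close> and \<open>E - F\<close> above 1 in
      modulus, so either half may be kept as \<open>B\<close>: the discarded one is large in any
      case.\<close>
    obtain F where F: "F \<in> sets M" "F \<subseteq> E" "cmod (\<nu> F) > 1 + cmod (\<nu> E)"
      using E unfolding U_def by (meson not_le)
    have Em: "E \<in> sets M" using E by (simp add: U_def)
    have "\<nu> (F \<union> (E - F)) = \<nu> F + \<nu> (E - F)"
      by (rule complex_measure_Un[OF \<nu>]) (use F Em in auto)
    moreover have "F \<union> (E - F) = E" using F by blast
    ultimately have sum: "\<nu> E = \<nu> F + \<nu> (E - F)" by simp
    have "cmod (\<nu> F) \<le> cmod (\<nu> E) + cmod (\<nu> (E - F))"
      using norm_triangle_ineq4[of "\<nu> E" "\<nu> (E - F)"] by (simp add: sum)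
    then have big: "cmod (\<nu> F) > 1" "cmod (\<nu> (E - F)) > 1"
      using F(3) norm_ge_zero[of "\<nu> E"] by linarith+
    have "U F \<or> U (E - F)"
    proof (rule ccontr)
      assume "\<not> ?thesis"
      then have "\<exists>K. \<forall>G\<in>sets M. G \<subseteq> F \<longrightarrow> cmod (\<nu> G) \<le> K"
        and "\<exists>L. \<forall>G\<in>sets M. G \<subseteq> E - F \<longrightarrow> cmod (\<nu> G) \<le> L"
        using F(1) Em by (simp_all add: U_def sets.Diff)
      then obtain K L where K: "\<forall>G\<in>sets M. G \<subseteq> F \<longrightarrow> cmod (\<nu> G) \<le> K"
        and L: "\<forall>G\<in>sets M. G \<subseteq> E - F \<longrightarrow> cmod (\<nu> G) \<le> L"
        by blast
      have "cmod (\<nu> G) \<le> K + L" if G: "G \<in> sets M" "G \<subseteq> E" for G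
      proof -
        have "\<nu> (G \<inter> F \<union> (G - F)) = \<nu> (G \<inter> F) + \<nu> (G - F)"
          by (rule complex_measure_Un[OF \<nu>]) (use F G in auto)
        moreover have "G \<inter> F \<union> (G - F) = G" by blast
        moreover have "cmod (\<nu> (G \<inter> F)) \<le> K"
          by (rule K[rule_format]) (use F(1) G in auto)
        moreover have "cmod (\<nu> (G - F)) \<le> L"
          by (rule L[rule_format]) (use F(1) G in auto)
        ultimately show ?thesis
          using norm_triangle_ineq[of "\<nu> (G \<inter> F)" "\<nu> (G - F)"] by simp
      qed
      with E show False unfolding U_def by blast
    qed
    moreover have "E - (E - F) = F" using F by blast
    ultimately show ?thesis using big F by (metis Diff_subset)
  qed
  have "\<exists>E. \<forall>n. U (E n) \<and> (E (Suc n) \<subseteq> E n \<and> cmod (\<nu> (E n - E (Suc n))) > 1)"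
  proof (rule dependent_nat_choice)
    have "U (space M)"
      using unbounded sets.sets_into_space[of _ M] by (auto simp: U_def)
    then show "\<exists>E. U E" ..
  qed (rule step)
  then obtain E where U: "\<And>n. U (E n)" and dec: "\<And>n. E (Suc n) \<subseteq> E n"
    and big: "\<And>n. cmod (\<nu> (E n - E (Suc n))) > 1"
    by blast
  have anti: "E n \<subseteq> E m" if "m \<le> n" for m n
    by (rule lift_Suc_antimono_le[of E m n, OF dec that])
  have disj: "(E m - E (Suc m)) \<inter> (E n - E (Suc n)) = {}" if "m < n" for m n
    using anti[of "Suc m" n] that by auto
  have "disjoint_family (\<lambda>n. E n - E (Suc n))"
    unfolding disjoint_family_on_def
  proof (intro ballI impI)
    fix m n :: nat assume "m \<noteq> n"
    then show "(E m - E (Suc m)) \<inter> (E n - E (Suc n)) = {}"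
      using disj[of m n] disj[of n m] by (cases "m < n") auto
  qed
  moreover have "range (\<lambda>n. E n - E (Suc n)) \<subseteq> sets M"
    using U by (auto simp: U_def)
  ultimately have "(\<lambda>n. \<nu> (E n - E (Suc n))) sums \<nu> (\<Union>n. E n - E (Suc n))"
    by (intro complex_measure_sums[OF \<nu>])
  then have "(\<lambda>n. \<nu> (E n - E (Suc n))) \<longlonglongrightarrow> 0"
    by (rule summable_LIMSEQ_zero[OF sums_summable])
  then obtain n where "cmod (\<nu> (E n - E (Suc n))) < 1"
    by (auto dest!: LIMSEQ_D[of _ _ 1])
  with big[of n] show False by simp
qed

lemma complex_measures_Re:
  "\<nu> \<in> complex_measures M \<Longrightarrow> (\<lambda>E. complex_of_real (Re (\<nu> E))) \<in> complex_measures M"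
  unfolding complex_measures_def by (auto intro!: sums_of_real sums_Re)

lemma complex_measures_Im:
  "\<nu> \<in> complex_measures M \<Longrightarrow> (\<lambda>E. complex_of_real (Im (\<nu> E))) \<in> complex_measures M"
  unfolding complex_measures_def by (auto intro!: sums_of_real sums_Im)

lemma complex_measures_minus:
  "\<nu> \<in> complex_measures M \<Longrightarrow> (\<lambda>E. - \<nu> E) \<in> complex_measures M"
  unfolding complex_measures_def by (auto intro!: sums_minus)

lemma sets_positive_variation [simp]: "sets (positive_variation M r) = sets M"
  by (simp add: positive_variation_def)

lemma space_positive_variation [simp]: "space (positive_variation M r) = space M"
  by (simp add: positive_variation_def)

lemma sets_total_variation [simp]: "sets (total_variation M \<nu>) = sets M"
  by (simp add: total_variation_def)

text \<open>A bound for the complex measure bounds the supremum over subsets of the whole space.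
  Finiteness lets the real-valued \<open>measure\<close> represent the variation and makes simple
  functions integrable.\<close>

lemma finite_measure_positive_variation:
  assumes r: "(\<lambda>E. complex_of_real (r E)) \<in> complex_measures M"
  shows "finite_measure (positive_variation M r)"
proof
  obtain K where K: "\<And>E. E \<in> sets M \<Longrightarrow> \<bar>r E\<bar> \<le> K"
    using complex_measure_bounded[OF r] by auto
  have "emeasure (positive_variation M r) (space M) \<le> ennreal K"
    unfolding emeasure_positive_variation[OF r sets.top]
    by (rule SUP_least) (use K in \<open>auto intro!: ennreal_leI intro: abs_le_D1\<close>)
  then show "emeasure (positive_variation M r) (space (positive_variation M r)) \<noteq> \<infinity>"
    by (auto simp: top_unique)
qed

text \<open>Jordan decomposition without a Hahn decomposition: for \<open>F \<subseteq> E\<close>,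
  \<open>r F = r E - r (E - F)\<close> is at most \<open>r E\<close> plus the negative variation of
  \<open>E\<close>. The supremum over \<open>F\<close> gives one inequality, and the same argument
  for \<open>- r\<close> gives the other.\<close>

lemma positive_variation_diff:
  assumes r: "(\<lambda>E. complex_of_real (r E)) \<in> complex_measures M" and E: "E \<in> sets M"
  shows "measure (positive_variation M r) E - measure (positive_variation M (\<lambda>E. - r E)) E = r E"
proof -
  have le: "measure (positive_variation M q) E \<le> q E + measure (positive_variation M (\<lambda>E. - q E)) E"
    if q: "(\<lambda>E. complex_of_real (q E)) \<in> complex_measures M" for q
  proof -
    let ?P = "positive_variation M q" and ?N = "positive_variation M (\<lambda>E. - q E)"
    have q': "(\<lambda>E. complex_of_real (- q E)) \<in> complex_measures M"
      using complex_measures_minus[OF q] by simp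
    interpret P: finite_measure ?P by (rule finite_measure_positive_variation[OF q])
    interpret N: finite_measure ?N by (rule finite_measure_positive_variation[OF q'])
    have *: "q F \<le> q E + measure ?N E" if F: "F \<in> sets M" "F \<subseteq> E" for F
    proof -
      have "complex_of_real (q (F \<union> (E - F))) = complex_of_real (q F) + complex_of_real (q (E - F))"
        by (rule complex_measure_Un[OF q]) (use E F in auto)
      moreover have "F \<union> (E - F) = E" using F by blast
      ultimately have "q E = q F + q (E - F)" by (metis of_real_add of_real_eq_iff)
      moreover have "ennreal (- q (E - F)) \<le> ennreal (measure ?N E)"
        unfolding N.emeasure_eq_measure[symmetric] emeasure_positive_variation[OF q' E]
        by (rule SUP_upper) (use E F in auto)
      then have "- q (E - F) \<le> measure ?N E"
        by (simp add: ennreal_le_iff)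
      ultimately show ?thesis by simp
    qed
    \<comment> \<open>Since \<open>ennreal\<close> truncates at 0, comparing real numbers through it
      requires the right-hand side to be nonnegative; the case \<open>F = {}\<close> shows
      this.\<close>
    have "q {} = 0"
      using complex_measure_empty[OF q] by simp
    then have nonneg: "0 \<le> q E + measure ?N E"
      using *[of "{}"] by simp
    have "ennreal (measure ?P E) \<le> ennreal (q E + measure ?N E)"
      unfolding P.emeasure_eq_measure[symmetric] emeasure_positive_variation[OF q E]
      by (rule SUP_least) (use * in \<open>auto intro!: ennreal_leI\<close>)
    with nonneg show ?thesis
      by (simp add: ennreal_le_iff)
  qed
  have "(\<lambda>E. complex_of_real (- r E)) \<in> complex_measures M"
    using complex_measures_minus[OF r] by simp
  from le[OF r] le[OF this] show ?thesis
    by simp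
qed

text \<open>Each \<open>F \<subseteq> E\<close> gives the partition of \<open>E\<close> into
  \<open>F\<close> and \<open>E - F\<close>, padded with empty sets, whose first term already
  dominates \<open>r F\<close>.\<close>

lemma positive_variation_le_total_variation:
  assumes \<nu>: "\<nu> \<in> complex_measures M" and r: "(\<lambda>E. complex_of_real (r E)) \<in> complex_measures M"
    and le: "\<And>E. E \<in> sets M \<Longrightarrow> r E \<le> cmod (\<nu> E)"
  shows "positive_variation M r \<le> total_variation M \<nu>"
proof -
  have "emeasure (positive_variation M r) E \<le> emeasure (total_variation M \<nu>) E" if E: "E \<in> sets M" for E
    unfolding emeasure_positive_variation[OF r E] emeasure_total_variation[OF \<nu> E]
  proof (rule SUP_least)
    fix F assume F: "F \<in> {F \<in> sets M. F \<subseteq> E}"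
    let ?A = "binaryset F (E - F)"
    have "?A \<in> measurable_partitions M E"
      unfolding measurable_partitions_def mem_Collect_eq UN_binaryset_eq
      using E F by (auto simp: range_binaryset_eq disjoint_family_on_def binaryset_def)
    moreover have "ennreal (r F) \<le> (\<Sum>n. ennreal (cmod (\<nu> (?A n))))"
    proof -
      have "ennreal (r F) \<le> ennreal (cmod (\<nu> (?A 0)))"
        using le F by (auto simp: binaryset_def intro: ennreal_leI)
      also have "\<dots> \<le> (\<Sum>n. ennreal (cmod (\<nu> (?A n))))"
      proof -
        have "(\<Sum>n\<in>{0}. ennreal (cmod (\<nu> (?A n)))) \<le> (\<Sum>n. ennreal (cmod (\<nu> (?A n))))"
          by (rule sum_le_suminf) auto
        then show ?thesis by (simp only: sum.insert sum.empty finite.emptyI empty_iff not_False_eq_True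
              add_0_right)
      qed
      finally show ?thesis .
    qed
    ultimately show "ennreal (r F) \<le>
        (SUP A\<in>measurable_partitions M E. \<Sum>n. ennreal (cmod (\<nu> (A n))))"
      by (rule SUP_upper2[where f = "\<lambda>A. \<Sum>n. ennreal (cmod (\<nu> (A n)))"])
  qed
  then show ?thesis
    by (subst le_measure) auto
qed

section \<open>Integration with respect to a complex measure\<close>

text \<open>Each variation is finite, so both Bochner integrals are finite sums over level sets; the
  Jordan decomposition merges their coefficients.\<close>

lemma signed_integral_simple:
  assumes r: "(\<lambda>E. complex_of_real (r E)) \<in> complex_measures M" and s: "simple_function M s"
  shows "signed_integral M r s = (\<Sum>y\<in>s ` space M. complex_of_real (r {x \<in> space M. s x = y}) * y)"
proof -
  have eq: "(LINT x|positive_variation M q. s x) =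
      (\<Sum>y\<in>s ` space M. measure (positive_variation M q) {x \<in> space M. s x = y} *\<^sub>R y)"
    if q: "(\<lambda>E. complex_of_real (q E)) \<in> complex_measures M" for q
  proof -
    interpret finite_measure "positive_variation M q"
      by (rule finite_measure_positive_variation[OF q])
    have "simple_function (positive_variation M q) s"
      using s by (simp add: simple_function_def)
    then have "Bochner_Integration.simple_bochner_integrable (positive_variation M q) s"
      by (simp add: simple_bochner_integrable.simps emeasure_eq_measure)
    from simple_bochner_integrable_eq_integral[OF this] show ?thesis
      by (simp add: simple_bochner_integral_def)
  qed
  have r': "(\<lambda>E. complex_of_real (- r E)) \<in> complex_measures M"
    using complex_measures_minus[OF r] by simp
  have E: "{x \<in> space M. s x = y} \<in> sets M" for y
    using simple_functionD(2)[OF s, of "{y}"] by (simp add: vimage_def Int_def conj_commute)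
  show ?thesis
    unfolding signed_integral_def eq[OF r] eq[OF r'] sum_subtractf[symmetric]
      scaleR_diff_left[symmetric] positive_variation_diff[OF r E]
    by (simp only: scaleR_conv_of_real)
qed

text \<open>This form exposes the dependence on \<open>\<nu>\<close>: only its values on the
  finitely many level sets of \<open>s\<close> enter, and they enter linearly.\<close>

lemma complex_integral_simple:
  assumes \<nu>: "\<nu> \<in> complex_measures M" and s: "simple_function M s"
  shows "complex_integral M \<nu> s = (\<Sum>y\<in>s ` space M. \<nu> {x \<in> space M. s x = y} * y)"
proof -
  have "\<nu> E * y = complex_of_real (Re (\<nu> E)) * y + \<i> * (complex_of_real (Im (\<nu> E)) * y)" for E y
    by (simp add: complex_eq_iff algebra_simps)
  then show ?thesis
    unfolding complex_integral_def signed_integral_simple[OF complex_measures_Re[OF \<nu>] s]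
      signed_integral_simple[OF complex_measures_Im[OF \<nu>] s] sum_distrib_left sum.distrib[symmetric]
    by simp
qed

text \<open>The integral combines four integrals against positive measures, the variations of the
  real and imaginary parts and of their negatives. All four are dominated by the total variation, so
  \<open>w\<close> is integrable for each.\<close>

lemma complex_integral_dominated_convergence:
  assumes \<nu>: "\<nu> \<in> complex_measures M"
    and [measurable]: "f \<in> borel_measurable M" "\<And>n. s n \<in> borel_measurable M" "w \<in> borel_measurable M"
    and w: "(\<integral>\<^sup>+x. ennreal (w x) \<partial>total_variation M \<nu>) < \<infinity>"
    and lim: "\<And>x. x \<in> space M \<Longrightarrow> (\<lambda>n. s n x) \<longlonglongrightarrow> f x"
    and bound: "\<And>n x. x \<in> space M \<Longrightarrow> cmod (s n x) \<le> w x"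
  shows "(\<lambda>n. complex_integral M \<nu> (s n)) \<longlonglongrightarrow> complex_integral M \<nu> f"
proof -
  have *: "(\<lambda>n. LINT x|positive_variation M r. s n x) \<longlonglongrightarrow> (LINT x|positive_variation M r. f x)"
    if r: "(\<lambda>E. complex_of_real (r E)) \<in> complex_measures M" and le: "\<And>E. r E \<le> cmod (\<nu> E)" for r
  proof (rule integral_dominated_convergence)
    have "(\<integral>\<^sup>+x. ennreal (w x) \<partial>positive_variation M r) \<le> (\<integral>\<^sup>+x. ennreal (w x) \<partial>total_variation M \<nu>)"
      by (rule nn_integral_mono_measure[OF _ positive_variation_le_total_variation[OF \<nu> r le]]) simp
    \<comment> \<open>Nonnegativity ensures that \<open>ennreal\<close> cuts nothing off
      \<open>w\<close>, so the finite integral is true integrability.\<close>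
    moreover have "0 \<le> w x" if "x \<in> space M" for x
      using bound[OF that, of 0] norm_ge_zero order_trans by blast
    ultimately show "integrable (positive_variation M r) w"
      using w by (intro integrableI_nonneg) (auto simp: measurable_cong_sets[OF sets_positive_variation refl])
  qed (use lim bound in \<open>auto simp: measurable_cong_sets[OF sets_positive_variation refl]\<close>)
  have **: "(\<lambda>n. signed_integral M r (s n)) \<longlonglongrightarrow> signed_integral M r f"
    if r: "(\<lambda>E. complex_of_real (r E)) \<in> complex_measures M" and le: "\<And>E. \<bar>r E\<bar> \<le> cmod (\<nu> E)" for r
    unfolding signed_integral_def
    using complex_measures_minus[OF r]
    by (intro tendsto_diff * r abs_le_D1[OF le] abs_le_D2[OF le]) simp
  then show ?thesis
    unfolding complex_integral_def
    by (intro tendsto_add tendsto_mult_left ** complex_measures_Re complex_measures_Im \<nu>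
        abs_Re_le_cmod abs_Im_le_cmod)
qed

section \<open>Integration with respect to a vector projection family\<close>

text \<open>Setwise continuity at 0 bounds the functional on a ball around 0, and linearity does the
  rest.\<close>

lemma vector_projection_family_bounded_clinear:
  fixes \<mu> :: "'a::complex_banach cdual \<Rightarrow> 'w set \<Rightarrow> complex"
  assumes \<mu>: "vector_projection_family M \<mu>" and E: "E \<in> sets M"
  shows "bounded_clinear (\<lambda>\<Lambda>. \<mu> \<Lambda> E)"
proof -
  have add: "\<mu> (\<Lambda> + \<Gamma>) E = \<mu> \<Lambda> E + \<mu> \<Gamma> E" and scale: "\<mu> (c *\<^sub>C \<Lambda>) E = c * \<mu> \<Lambda> E" for \<Lambda> \<Gamma> c
    using \<mu> E by (auto simp: vector_projection_family_def)
  have lin: "linear (\<lambda>\<Lambda>. \<mu> \<Lambda> E)"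
    by (rule linearI) (simp_all add: add scale scaleC_complex_of_real[symmetric] scaleR_conv_of_real)
  \<comment> \<open>The net is the identity along the neighbourhood filter of 0.\<close>
  have "((\<lambda>\<Lambda>. \<mu> \<Lambda> E) \<longlongrightarrow> \<mu> 0 E) (nhds 0)"
    using vector_projection_family_net[OF \<mu> filterlim_ident[of "nhds 0"]] E
    by (simp add: setwise_tendsto_def)
  then have "eventually (\<lambda>\<Lambda>. dist (\<mu> \<Lambda> E) (\<mu> 0 E) < 1) (nhds 0)"
    by (rule tendstoD) simp
  then obtain d where d: "d > 0" "\<And>\<Lambda>. dist \<Lambda> 0 < d \<Longrightarrow> dist (\<mu> \<Lambda> E) (\<mu> 0 E) < 1"
    by (auto simp: eventually_nhds_metric)
  \<comment> \<open>Halving \<open>d\<close> fits a closed ball inside the open one.\<close>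
  have "cmod (\<mu> \<Lambda> E) \<le> 1" if "norm \<Lambda> \<le> d / 2" for \<Lambda>
    using d(2)[of \<Lambda>] that d(1) linear_0[OF lin] by (simp add: dist_norm)
  then have "bounded_linear (\<lambda>\<Lambda>. \<mu> \<Lambda> E)"
    using d(1) by (intro bounded_linear_if_bounded_on_cball[OF lin, of "d / 2" 1]) auto
  then show ?thesis
    by (simp add: bounded_clinear_def scale)
qed

lemma bounded_clinear_complex_integral_simple:
  fixes \<mu> :: "'a::complex_banach cdual \<Rightarrow> 'w set \<Rightarrow> complex"
  assumes \<mu>: "vector_projection_family M \<mu>" and s: "simple_function M s"
  shows "bounded_clinear (\<lambda>\<Lambda>. complex_integral M (\<mu> \<Lambda>) s)"
proof -
  have "{x \<in> space M. s x = y} \<in> sets M" for y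
    using simple_functionD(2)[OF s, of "{y}"] by (simp add: vimage_def Int_def conj_commute)
  from vector_projection_family_bounded_clinear[OF \<mu> this]
  have "bounded_clinear (\<lambda>\<Lambda>. \<Sum>y\<in>s ` space M. \<mu> \<Lambda> {x \<in> space M. s x = y} * y)"
    by (auto simp: bounded_clinear_def sum_distrib_left mult.assoc
        intro!: bounded_linear_sum bounded_linear_mult_const)
  moreover have "\<mu> \<Lambda> \<in> complex_measures M" for \<Lambda>
    using \<mu> by (simp add: vector_projection_family_def)
  ultimately show ?thesis
    by (simp add: complex_integral_simple s)
qed

theorem mainTheorem1:
  fixes M :: "'w measure"
    and \<mu> :: "'a::complex_banach cdual \<Rightarrow> 'w set \<Rightarrow> complex"
    and f :: "'w \<Rightarrow> complex"
  assumes "vector_projection_family M \<mu>"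
    and "vpf_integrable M \<mu> f"
  shows "\<exists>\<Phi> :: 'a cdual cdual. cdual_apply \<Phi> = (\<lambda>\<Lambda>. complex_integral M (\<mu> \<Lambda>) f)"
proof -
  have \<nu>: "\<mu> \<Lambda> \<in> complex_measures M" for \<Lambda>
    using assms(1) by (simp add: vector_projection_family_def)
  have f: "f \<in> borel_measurable M"
    and fin: "(\<integral>\<^sup>+x. ennreal (cmod (f x)) \<partial>total_variation M (\<mu> \<Lambda>)) < \<infinity>" for \<Lambda>
    using assms(2) by (auto simp: vpf_integrable_def)
  \<comment> \<open>The factor 2 comes from the metric approximation theorem with base point 0: the
    distance of \<open>s n x\<close> from 0 is at most twice that of \<open>f x\<close>.\<close>
  obtain s where s: "\<And>n. simple_function M (s n)"
    and lim: "\<And>x. x \<in> space M \<Longrightarrow> (\<lambda>n. s n x) \<longlonglongrightarrow> f x"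
    and bound: "\<And>n x. x \<in> space M \<Longrightarrow> cmod (s n x) \<le> 2 * cmod (f x)"
    using borel_measurable_implies_sequence_metric[OF f, of 0]
    by (simp only: dist_norm diff_0_right) blast
  have fin2: "(\<integral>\<^sup>+x. ennreal (2 * cmod (f x)) \<partial>total_variation M (\<mu> \<Lambda>)) < \<infinity>" for \<Lambda>
  proof -
    have "f \<in> borel_measurable (total_variation M (\<mu> \<Lambda>))"
      using f by (simp add: measurable_cong_sets[OF sets_total_variation refl])
    then show ?thesis
      using fin[of \<Lambda>] by (simp add: ennreal_mult nn_integral_cmult ennreal_mult_less_top)
  qed
  have conv: "(\<lambda>n. complex_integral M (\<mu> \<Lambda>) (s n)) \<longlonglongrightarrow> complex_integral M (\<mu> \<Lambda>) f" for \<Lambda>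
    by (rule complex_integral_dominated_convergence[OF \<nu> f _ _ fin2 lim bound])
      (use f s in \<open>auto intro: borel_measurable_simple_function\<close>)
  have T: "bounded_clinear (\<lambda>\<Lambda>. complex_integral M (\<mu> \<Lambda>) (s n))" for n
    by (rule bounded_clinear_complex_integral_simple[OF assms(1) s])
  have "bounded_linear (\<lambda>\<Lambda>. complex_integral M (\<mu> \<Lambda>) f)"
    by (rule bounded_linear_pointwise_limit[OF _ conv]) (use T in \<open>simp add: bounded_clinear_def\<close>)
  \<comment> \<open>Banach--Steinhaus was applied over the reals, so complex homogeneity is carried
    to the limit separately.\<close>
  moreover have "complex_integral M (\<mu> (c *\<^sub>C \<Lambda>)) f = c * complex_integral M (\<mu> \<Lambda>) f" for c \<Lambda>
  proof (rule LIMSEQ_unique[OF conv])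
    show "(\<lambda>n. complex_integral M (\<mu> (c *\<^sub>C \<Lambda>)) (s n)) \<longlonglongrightarrow> c * complex_integral M (\<mu> \<Lambda>) f"
      using T tendsto_mult_left[OF conv] by (simp add: bounded_clinear_def)
  qed
  ultimately have "bounded_clinear (\<lambda>\<Lambda>. complex_integral M (\<mu> \<Lambda>) f)"
    by (simp add: bounded_clinear_def)
  then show ?thesis
    by (intro exI[of _ "CDual (\<lambda>\<Lambda>. complex_integral M (\<mu> \<Lambda>) f)"] CDual_inverse) simp
qed

end
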